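(* Let $(M,d,f)$ be an augmented metric space with density-Rips persistent set $S$. Let $A\subset M$ be a non-empty set of points for which there exists a point $y\in M\setminus A$ such that for every $x\in A$ one has $f(y)\le f(x)$ and, for each graph $\mathcal{G}_\varepsilon(M_\sigma)$ (with $\varepsilon\ge 0$, $\sigma\in\mathbb{R}$) that contains $x$ as a vertex, either - $x$ is path-connected to $y$ in $\mathcal{G}_\varepsilon(M_\sigma)$, or - the set of points that are path-connected to $x$ in $\mathcal{G}_\varepsilon(M_\sigma)$ is contained in $A$. Then the set of generators $\{(p_x,x): x\in A\}$ is a rooted subset of $S$.
   Context: Let $P$ be a finite poset, viewed as a category. A persistent set over $P$ is a functor $S\colon P\to\mathsf{Set}$ to finite sets, with maps $S_{p\to q}\colon S_p\to S_q$ for $p\le q$; morphisms are natural transformations. An endomorphism $\varphi$ is idempotent if $\varphi\circ\varphi=\varphi$. A generator of $S$ is a pair $(p_x,x)$ with $x\in S_{p_x}$ such that $x$ is not in the image of $S_{q\to p_x}$ for any $q<p_x$. A generator $(p_x,x)$ is fixed by an endomorphism $\varphi$ of $S$ if $\varphi_{p_x}(x)=x$. A rooted subset of $S$ is a non-empty subset $A$ of the generators of $S$ such that there is an idempotent endomorphism $\varphi$ of $S$ whose set of generators that are not fixed is precisely $A$. An augmented metric space is a triple $(M,d,f)$ with $(M,d)$ a finite metric space and $f\colon M\to\mathbb{R}$ a function. For $\sigma\in\mathbb{R}$ put $M_\sigma:=\{x\in M: f(x)\le\sigma\}$. For a finite metric space $N$ and $\varepsilon\ge 0$, $\mathcal{G}_\varepsilon(N)$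 is the undirected graph with vertex set $N$ and an edge between $x,y$ whenever $d(x,y)\le\varepsilon$. Put $P:=D\times T\subset\mathbb{R}_{\ge0}\times\mathbb{R}$ with $D:=\{d(x,y):x,y\in M\}$ and $T:=\{f(x):x\in M\}$, ordered by $(\varepsilon,\sigma)\le(\varepsilon',\sigma')$ iff $\varepsilon\le\varepsilon'$ and $\sigma\le\sigma'$. The density-Rips persistent set of $(M,d,f)$ is the functor $S\colon P\to\mathsf{Set}$ sending $(\varepsilon,\sigma)$ to the set of connected components of $\mathcal{G}_\varepsilon(M_\sigma)$, with maps induced by the inclusions of graphs. Points of $M$ correspond bijectively to generators of $S$: the point $x\in M$ corresponds to the generator $(p_x,x)$ with $p_x=(0,f(x))$, given by the connected component $\{x\}$ of $\mathcal{G}_0(M_{f(x)})$. *)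

theory Defs
  imports "HOL-Analysis.Analysis" "HOL-Library.Product_Order"
begin

text \<open>The poset is a finite subset \<open>base S\<close> of an ordered type, with the inherited order.
  As usual for partial data in HOL, \<open>obj S p\<close> and \<open>mor S p q\<close> carry information only for
  \<open>p, q \<in> base S\<close> with \<open>p \<le> q\<close>, and \<open>mor S p q\<close> only on \<open>obj S p\<close>.\<close>

record ('p, 'x) pset =
  base :: "'p set"
  obj :: "'p \<Rightarrow> 'x set"
  mor :: "'p \<Rightarrow> 'p \<Rightarrow> 'x \<Rightarrow> 'x"

definition persistent_set :: "('p::order, 'x) pset \<Rightarrow> bool" where
  "persistent_set S \<longleftrightarrow>
     finite (base S) \<and>
     (\<forall>p\<in>base S. finite (obj S p)) \<and>
     (\<forall>p\<in>base S. \<forall>q\<in>base S. p \<le> q \<longrightarrow> mor S p q \<in> obj S p \<rightarrow> obj S q) \<and>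
     (\<forall>p\<in>base S. \<forall>x\<in>obj S p. mor S p p x = x) \<and>
     (\<forall>p\<in>base S. \<forall>q\<in>base S. \<forall>r\<in>base S. p \<le> q \<longrightarrow> q \<le> r \<longrightarrow>
        (\<forall>x\<in>obj S p. mor S q r (mor S p q x) = mor S p r x))"

definition pset_morphism ::
  "('p::order, 'x) pset \<Rightarrow> ('p, 'y) pset \<Rightarrow> ('p \<Rightarrow> 'x \<Rightarrow> 'y) \<Rightarrow> bool" where
  "pset_morphism S T \<phi> \<longleftrightarrow>
     base S = base T \<and>
     (\<forall>p\<in>base S. \<phi> p \<in> obj S p \<rightarrow> obj T p) \<and>
     (\<forall>p\<in>base S. \<forall>q\<in>base S. p \<le> q \<longrightarrow>
        (\<forall>x\<in>obj S p. \<phi> q (mor S p q x) = mor T p q (\<phi> p x)))"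

definition idempotent_endomorphism ::
  "('p::order, 'x) pset \<Rightarrow> ('p \<Rightarrow> 'x \<Rightarrow> 'x) \<Rightarrow> bool" where
  "idempotent_endomorphism S \<phi> \<longleftrightarrow>
     pset_morphism S S \<phi> \<and> (\<forall>p\<in>base S. \<forall>x\<in>obj S p. \<phi> p (\<phi> p x) = \<phi> p x)"

definition generators :: "('p::order, 'x) pset \<Rightarrow> ('p \<times> 'x) set" where
  "generators S =
     {(p, x). p \<in> base S \<and> x \<in> obj S p \<and> (\<forall>q\<in>base S. q < p \<longrightarrow> x \<notin> mor S q p ` obj S q)}"

definition fixed_by :: "('p \<Rightarrow> 'x \<Rightarrow> 'x) \<Rightarrow> 'p \<times> 'x \<Rightarrow> bool" where
  "fixed_by \<phi> g \<longleftrightarrow> \<phi> (fst g) (snd g) = snd g"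

definition rooted_subset :: "('p::order, 'x) pset \<Rightarrow> ('p \<times> 'x) set \<Rightarrow> bool" where
  "rooted_subset S A \<longleftrightarrow>
     A \<noteq> {} \<and> A \<subseteq> generators S \<and>
     (\<exists>\<phi>. idempotent_endomorphism S \<phi> \<and> {g \<in> generators S. \<not> fixed_by \<phi> g} = A)"

definition augmented_metric_space ::
  "'a set \<Rightarrow> ('a \<Rightarrow> 'a \<Rightarrow> real) \<Rightarrow> ('a \<Rightarrow> real) \<Rightarrow> bool" where
  "augmented_metric_space M d f \<longleftrightarrow> Metric_space M d \<and> finite M"

definition sublevel :: "'a set \<Rightarrow> ('a \<Rightarrow> real) \<Rightarrow> real \<Rightarrow> 'a set" where
  "sublevel M f \<sigma> = {x \<in> M. f x \<le> \<sigma>}"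

text \<open>The graph with vertex set \<open>N\<close> is given by its symmetric edge relation. It includes loops,
  which are irrelevant for connectivity.\<close>

definition rips_edges :: "('a \<Rightarrow> 'a \<Rightarrow> real) \<Rightarrow> real \<Rightarrow> 'a set \<Rightarrow> 'a rel" where
  "rips_edges d \<epsilon> N = {(x, y). x \<in> N \<and> y \<in> N \<and> d x y \<le> \<epsilon>}"

text \<open>The restriction to \<open>N \<times> N\<close> is needed because \<open>rtrancl\<close> is reflexive on the whole type.\<close>

definition path_conn :: "('a \<Rightarrow> 'a \<Rightarrow> real) \<Rightarrow> real \<Rightarrow> 'a set \<Rightarrow> 'a rel" where
  "path_conn d \<epsilon> N = (rips_edges d \<epsilon> N)\<^sup>* \<inter> N \<times> N"

definition components_of_rips :: "('a \<Rightarrow> 'a \<Rightarrow> real) \<Rightarrow> real \<Rightarrow> 'a set \<Rightarrow> 'a set set" where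
  "components_of_rips d \<epsilon> N = N // path_conn d \<epsilon> N"

text \<open>The map induced by an inclusion of graphs sends a component \<open>C\<close> of the smaller graph to the
  set of vertices of the larger graph connected there to a point of \<open>C\<close>; by
  \<open>density_rips_mor\<close> below this is the unique component containing \<open>C\<close>.\<close>

definition density_rips ::
  "'a set \<Rightarrow> ('a \<Rightarrow> 'a \<Rightarrow> real) \<Rightarrow> ('a \<Rightarrow> real) \<Rightarrow> (real \<times> real, 'a set) pset" where
  "density_rips M d f =
     \<lparr> base = {d x y | x y. x \<in> M \<and> y \<in> M} \<times> f ` M,
       obj = (\<lambda>(\<epsilon>, \<sigma>). components_of_rips d \<epsilon> (sublevel M f \<sigma>)),
       mor = (\<lambda>_ (\<epsilon>, \<sigma>) C. path_conn d \<epsilon> (sublevel M f \<sigma>) `` C) \<rparr>"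

definition point_generator :: "('a \<Rightarrow> real) \<Rightarrow> 'a \<Rightarrow> (real \<times> real) \<times> 'a set" where
  "point_generator f x = ((0, f x), {x})"

context Metric_space
begin

lemma equiv_path_conn:
  assumes "N \<subseteq> M" shows "equiv N (path_conn d \<epsilon> N)"
proof -
  have "sym (rips_edges d \<epsilon> N)"
    using commute by (auto simp: rips_edges_def sym_def)
  then have "sym ((rips_edges d \<epsilon> N)\<^sup>*)"
    by (rule sym_rtrancl)
  moreover have "trans ((rips_edges d \<epsilon> N)\<^sup>*)"
    by (rule trans_rtrancl)
  ultimately show ?thesis
    unfolding equiv_def path_conn_def refl_on_def sym_def trans_def by blast
qed

lemma path_conn_mono:
  assumes "N \<subseteq> N'" "\<epsilon> \<le> \<epsilon>'"
  shows "path_conn d \<epsilon> N \<subseteq> path_conn d \<epsilon>' N'"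
proof -
  have "rips_edges d \<epsilon> N \<subseteq> rips_edges d \<epsilon>' N'"
    using assms by (auto simp: rips_edges_def)
  then have "(rips_edges d \<epsilon> N)\<^sup>* \<subseteq> (rips_edges d \<epsilon>' N')\<^sup>*"
    by (rule rtrancl_mono)
  then show ?thesis
    using assms unfolding path_conn_def by blast
qed

lemma path_conn_Image_class:
  assumes "N \<subseteq> N'" "N' \<subseteq> M" "\<epsilon> \<le> \<epsilon>'" "x \<in> N"
  shows "path_conn d \<epsilon>' N' `` (path_conn d \<epsilon> N `` {x}) = path_conn d \<epsilon>' N' `` {x}"
proof -
  have e: "equiv N (path_conn d \<epsilon> N)" and e': "equiv N' (path_conn d \<epsilon>' N')"
    using equiv_path_conn assms by auto
  have "(x, x) \<in> path_conn d \<epsilon> N"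
    using e \<open>x \<in> N\<close> by (simp add: equiv_def refl_on_def)
  moreover have "trans (path_conn d \<epsilon>' N')"
    using e' by (simp add: equiv_def)
  ultimately show ?thesis
    using path_conn_mono[OF assms(1,3)] unfolding trans_def by blast
qed

lemma sublevel_subset: "sublevel M f \<sigma> \<subseteq> M"
  by (auto simp: sublevel_def)

lemma sublevel_mono: "\<sigma> \<le> \<sigma>' \<Longrightarrow> sublevel M f \<sigma> \<subseteq> sublevel M f \<sigma>'"
  by (auto simp: sublevel_def)

lemma path_conn_zero:
  assumes "N \<subseteq> M" shows "path_conn d 0 N = Id_on N"
proof -
  have "rips_edges d 0 N \<subseteq> Id"
  proof
    fix e assume "e \<in> rips_edges d 0 N"
    then obtain x y where e: "e = (x, y)" "x \<in> N" "y \<in> N" "d x y \<le> 0"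
      by (auto simp: rips_edges_def)
    then have "d x y = 0"
      using nonneg[of x y] by linarith
    then show "e \<in> Id"
      using e zero[of x y] assms by (simp add: subset_iff)
  qed
  then have "(rips_edges d 0 N)\<^sup>* \<subseteq> Id"
    using rtrancl_mono[of "rips_edges d 0 N" Id] by simp
  then show ?thesis
    by (auto simp: path_conn_def)
qed

lemma density_rips_mor_class:
  assumes "p \<le> q" "x \<in> sublevel M f (snd p)"
  shows "mor (density_rips M d f) p q (path_conn d (fst p) (sublevel M f (snd p)) `` {x}) =
    path_conn d (fst q) (sublevel M f (snd q)) `` {x}"
proof -
  have "fst p \<le> fst q" "snd p \<le> snd q"
    using assms by (auto simp: less_eq_prod_def)
  then show ?thesis
    using path_conn_Image_class[OF sublevel_mono sublevel_subset] assms(2)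
    by (simp add: density_rips_def case_prod_beta)
qed

lemma density_rips_objE:
  assumes "C \<in> obj (density_rips M d f) p"
  obtains x where "x \<in> sublevel M f (snd p)"
    "C = path_conn d (fst p) (sublevel M f (snd p)) `` {x}"
  using assms
  by (auto simp: density_rips_def case_prod_beta components_of_rips_def elim: quotientE)

lemma density_rips_objI:
  assumes "x \<in> sublevel M f (snd p)"
  shows "path_conn d (fst p) (sublevel M f (snd p)) `` {x} \<in> obj (density_rips M d f) p"
  using assms by (auto simp: density_rips_def case_prod_beta components_of_rips_def quotientI)

lemma density_rips_mor:
  assumes "p \<le> q" and C: "C \<in> obj (density_rips M d f) p"
  shows "mor (density_rips M d f) p q C \<in> obj (density_rips M d f) q"
    and "C \<subseteq> mor (density_rips M d f) p q C"
    and "C' \<in> obj (density_rips M d f) q \<Longrightarrow> C \<subseteq> C' \<Longrightarrow> C' = mor (density_rips M d f) p q C"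
proof -
  let ?Np = "sublevel M f (snd p)" and ?Nq = "sublevel M f (snd q)"
  let ?cp = "path_conn d (fst p) ?Np" and ?cq = "path_conn d (fst q) ?Nq"
  have le: "fst p \<le> fst q" "snd p \<le> snd q"
    using \<open>p \<le> q\<close> by (simp_all add: less_eq_prod_def)
  note sub = sublevel_mono[OF le(2), of f]
  obtain x where x: "x \<in> ?Np" "C = ?cp `` {x}"
    using C by (rule density_rips_objE)
  have m: "mor (density_rips M d f) p q C = ?cq `` {x}"
    unfolding x(2) by (rule density_rips_mor_class[OF \<open>p \<le> q\<close> x(1)])
  show "mor (density_rips M d f) p q C \<in> obj (density_rips M d f) q"
    unfolding m by (rule density_rips_objI[OF subsetD[OF sub x(1)]])
  show "C \<subseteq> mor (density_rips M d f) p q C"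
    unfolding m unfolding x(2) by (rule Image_mono[OF path_conn_mono[OF sub le(1)] order_refl])
  assume C': "C' \<in> obj (density_rips M d f) q" and "C \<subseteq> C'"
  obtain z where z: "z \<in> ?Nq" "C' = ?cq `` {z}"
    using C' by (rule density_rips_objE)
  have "x \<in> C"
    unfolding x(2) by (rule equiv_class_self[OF equiv_path_conn[OF sublevel_subset] x(1)])
  then have "(z, x) \<in> ?cq"
    using \<open>C \<subseteq> C'\<close> unfolding z(2) by blast
  then show "C' = mor (density_rips M d f) p q C"
    unfolding m unfolding z(2) by (rule equiv_class_eq[OF equiv_path_conn[OF sublevel_subset]])
qed

theorem persistent_set_density_rips:
  assumes "finite M" shows "persistent_set (density_rips M d f)"
  unfolding persistent_set_def
proof (intro conjI ballI impI)
  let ?S = "density_rips M d f"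
  have "{d x y |x y. x \<in> M \<and> y \<in> M} = (\<lambda>(x, y). d x y) ` (M \<times> M)"
    by auto
  then show "finite (base ?S)"
    using assms by (simp add: density_rips_def)
  fix p :: "real \<times> real"
  have "finite (sublevel M f (snd p))"
    by (rule finite_subset[OF sublevel_subset assms])
  moreover have "path_conn d (fst p) (sublevel M f (snd p))
      \<subseteq> sublevel M f (snd p) \<times> sublevel M f (snd p)"
    by (simp add: path_conn_def)
  ultimately show "finite (obj ?S p)"
    by (simp add: density_rips_def case_prod_beta components_of_rips_def finite_quotient)
  show "mor ?S p p C = C" if "C \<in> obj ?S p" for C
    using density_rips_mor(3)[OF order_refl that that] by simp
  fix q assume "p \<le> q"
  show "mor ?S p q \<in> obj ?S p \<rightarrow> obj ?S q"
    using density_rips_mor(1)[OF \<open>p \<le> q\<close>] by blast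
  fix r C assume "q \<le> r" "C \<in> obj ?S p"
  note C = this(2)
  show "mor ?S q r (mor ?S p q C) = mor ?S p r C"
  proof (rule density_rips_mor(3)[OF order_trans[OF \<open>p \<le> q\<close> \<open>q \<le> r\<close>] C])
    note pq = density_rips_mor(1,2)[OF \<open>p \<le> q\<close> C]
    show "mor ?S q r (mor ?S p q C) \<in> obj ?S r"
      by (rule density_rips_mor(1)[OF \<open>q \<le> r\<close> pq(1)])
    show "C \<subseteq> mor ?S q r (mor ?S p q C)"
      by (rule subset_trans[OF pq(2) density_rips_mor(2)[OF \<open>q \<le> r\<close> pq(1)]])
  qed
qed

theorem bij_betw_point_generator:
  "bij_betw (point_generator f) M (generators (density_rips M d f))"
  unfolding bij_betw_def
proof
  let ?S = "density_rips M d f"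
  show "inj_on (point_generator f) M"
    by (auto simp: inj_on_def point_generator_def)
  have base: "(0, f x) \<in> base ?S" if "x \<in> M" for x
  proof -
    have "d x x = 0"
      using that by simp
    then have "0 \<in> {d x y | x y. x \<in> M \<and> y \<in> M}"
      by (intro CollectI exI[of _ x]) (simp add: that)
    then show ?thesis
      using that by (simp add: density_rips_def)
  qed
  have singleton: "path_conn d 0 (sublevel M f \<sigma>) `` {x} = {x}" if "x \<in> sublevel M f \<sigma>" for x \<sigma>
    using that by (auto simp: path_conn_zero[OF sublevel_subset])
  have sub: "x \<in> sublevel M f (f x)" if "x \<in> M" for x
    using that by (simp add: sublevel_def)
  show "point_generator f ` M = generators ?S"
  proof (intro equalityI subsetI)
    fix g assume "g \<in> point_generator f ` M"
    then obtain x where x: "x \<in> M" "g = ((0, f x), {x})"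
      by (auto simp: point_generator_def)
    have "{x} \<in> obj ?S (0, f x)"
      using density_rips_objI[of x f "(0, f x)"] sub[OF x(1)] singleton[OF sub[OF x(1)]] by simp
    moreover have "{x} \<notin> mor ?S q (0, f x) ` obj ?S q"
      if q: "q \<in> base ?S" "q < (0, f x)" for q
    proof
      assume "{x} \<in> mor ?S q (0, f x) ` obj ?S q"
      then obtain C where C: "C \<in> obj ?S q" "{x} = mor ?S q (0, f x) C"
        by blast
      have "fst q \<ge> 0"
        using q(1) by (auto simp: density_rips_def)
      then have "snd q < f x"
        using q(2) by (auto simp: less_prod_def less_eq_prod_def)
      obtain z where z: "z \<in> sublevel M f (snd q)"
        "C = path_conn d (fst q) (sublevel M f (snd q)) `` {z}"
        using C(1) by (rule density_rips_objE)
      have "z \<in> C"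
        using equiv_class_self[OF equiv_path_conn[OF sublevel_subset] z(1)] z(2) by simp
      moreover have "C \<subseteq> {x}"
        using density_rips_mor(2)[OF order.strict_implies_order[OF q(2)] C(1)] C(2) by simp
      ultimately have "z = x"
        by blast
      then show False
        using z(1) \<open>snd q < f x\<close> by (simp add: sublevel_def)
    qed
    ultimately show "g \<in> generators ?S"
      using base x by (simp add: generators_def)
  next
    fix g assume g: "g \<in> generators ?S"
    obtain p C where pC: "g = (p, C)"
      by (cases g)
    then have p: "p \<in> base ?S" and C: "C \<in> obj ?S p"
      and min: "\<And>q. q \<in> base ?S \<Longrightarrow> q < p \<Longrightarrow> C \<notin> mor ?S q p ` obj ?S q"
      using g by (auto simp: generators_def)
    obtain x where x: "x \<in> sublevel M f (snd p)"
      "C = path_conn d (fst p) (sublevel M f (snd p)) `` {x}"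
      using C by (rule density_rips_objE)
    then have xM: "x \<in> M" and "f x \<le> snd p"
      by (auto simp: sublevel_def)
    moreover have "fst p \<ge> 0"
      using p by (auto simp: density_rips_def)
    ultimately have le: "(0, f x) \<le> p"
      by (simp add: less_eq_prod_def)
    have "C = mor ?S (0, f x) p {x}" "{x} \<in> obj ?S (0, f x)"
      using density_rips_mor_class[OF le, of x f] density_rips_objI[of x f "(0, f x)"]
        sub[OF xM] singleton[OF sub[OF xM]] x(2) by simp_all
    then have "\<not> (0, f x) < p"
      using min[OF base[OF xM]] by blast
    then have "p = (0, f x)"
      using le by (simp add: order_less_le)
    then show "g \<in> point_generator f ` M"
      using pC x singleton[OF sub[OF xM]] xM by (auto simp: point_generator_def)
  qed
qed

end

end

theory Submission
  imports Defs
begin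

text \<open>
  Write \<open>[x]\<^sub>p\<close> for the component of \<open>x\<close> in the graph at the grade \<open>p\<close>. The idempotent
  endomorphism that roots \<open>A\<close> at \<open>y\<close> sends every component contained in \<open>A\<close> to \<open>[y]\<^sub>p\<close> and leaves
  all other components alone. The two parts of the hypothesis on \<open>A\<close> are what makes this
  a natural transformation: \<open>f y \<le> f x\<close> for \<open>x \<in> A\<close> ensures that \<open>y\<close> is already present wherever a
  component contained in \<open>A\<close> is, so that \<open>[y]\<^sub>p\<close> exists; and the dichotomy says that once the
  component of a point of \<open>A\<close> leaves \<open>A\<close>, it is the component of \<open>y\<close>, so at the moment when the
  map stops redirecting a component there is nothing left to redirect
  (\<open>pset_morphism_collapse\<close>).

  The map is idempotent because \<open>[y]\<^sub>p\<close> contains \<open>y \<notin> A\<close> and is therefore left alone. A generator is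
  a singleton \<open>{x}\<close> at grade \<open>(0, f x)\<close>, where components are singletons; it is moved, to \<open>{y}\<close>,
  exactly if \<open>x \<in> A\<close>.
\<close>

definition rips_class ::
  "'a set \<Rightarrow> ('a \<Rightarrow> 'a \<Rightarrow> real) \<Rightarrow> ('a \<Rightarrow> real) \<Rightarrow> real \<times> real \<Rightarrow> 'a \<Rightarrow> 'a set" where
  "rips_class M d f p x = path_conn d (fst p) (sublevel M f (snd p)) `` {x}"

definition collapse ::
  "'a set \<Rightarrow> ('a \<Rightarrow> 'a \<Rightarrow> real) \<Rightarrow> ('a \<Rightarrow> real) \<Rightarrow> 'a set \<Rightarrow> 'a \<Rightarrow> real \<times> real \<Rightarrow> 'a set \<Rightarrow> 'a set"
  where "collapse M d f A y p C = (if C \<subseteq> A then rips_class M d f p y else C)"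

context Metric_space
begin

lemma rips_class_self:
  "x \<in> sublevel M f (snd p) \<Longrightarrow> x \<in> rips_class M d f p x"
  unfolding rips_class_def by (rule equiv_class_self[OF equiv_path_conn[OF sublevel_subset]])

lemma rips_class_eq:
  "(x, y) \<in> path_conn d (fst p) (sublevel M f (snd p)) \<Longrightarrow> rips_class M d f p x = rips_class M d f p y"
  unfolding rips_class_def by (rule equiv_class_eq[OF equiv_path_conn[OF sublevel_subset]])

lemma rips_class_zero:
  "x \<in> sublevel M f \<sigma> \<Longrightarrow> rips_class M d f (0, \<sigma>) x = {x}"
  by (auto simp: rips_class_def path_conn_zero[OF sublevel_subset])

lemma density_rips_grade_nonneg: "p \<in> base (density_rips M d f) \<Longrightarrow> 0 \<le> fst p"
  by (auto simp: density_rips_def)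

text \<open>Naturality along \<open>p \<le> q\<close> is in question only for a component \<open>[x]\<^sub>p \<subseteq> A\<close>. Moving it to \<open>[y]\<^sub>p\<close> and
  then on to \<open>q\<close> gives \<open>[y]\<^sub>q\<close>; going to \<open>[x]\<^sub>q\<close> first gives the same, either because \<open>[x]\<^sub>q \<subseteq> A\<close> is
  moved as well, or because \<open>[x]\<^sub>q = [y]\<^sub>q\<close> by \<open>merge\<close>. A component that is not contained in \<open>A\<close> stays so,
  as components only grow.\<close>

lemma pset_morphism_collapse:
  assumes yM: "y \<in> M"
    and early: "\<And>x. x \<in> A \<Longrightarrow> f y \<le> f x"
    and merge: "\<And>p x. 0 \<le> fst p \<Longrightarrow> x \<in> A \<Longrightarrow> x \<in> sublevel M f (snd p) \<Longrightarrow>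
      \<not> rips_class M d f p x \<subseteq> A \<Longrightarrow> rips_class M d f p x = rips_class M d f p y"
  shows "pset_morphism (density_rips M d f) (density_rips M d f) (collapse M d f A y)"
proof -
  let ?S = "density_rips M d f" and ?c = "rips_class M d f" and ?\<phi> = "collapse M d f A y"
  have y_present: "y \<in> sublevel M f (snd p)"
    if "x \<in> sublevel M f (snd p)" "x \<in> A" for x p
    using that early[of x] yM by (auto simp: sublevel_def)
  have mor_class: "mor ?S p q (?c p x) = ?c q x"
    if "p \<le> q" "x \<in> sublevel M f (snd p)" for p q x
    unfolding rips_class_def using that by (rule density_rips_mor_class)
  have maps: "?\<phi> p C \<in> obj ?S p" if C: "C \<in> obj ?S p" for p C
  proof (cases "C \<subseteq> A")
    case True
    obtain x where x: "x \<in> sublevel M f (snd p)" "C = ?c p x"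
      using C unfolding rips_class_def by (rule density_rips_objE)
    then have "x \<in> A"
      using True rips_class_self by blast
    then have "?c p y \<in> obj ?S p"
      unfolding rips_class_def by (intro density_rips_objI y_present[OF x(1)])
    then show ?thesis
      using True by (simp add: collapse_def)
  next
    case False
    then show ?thesis
      using C by (simp add: collapse_def)
  qed
  have natural: "?\<phi> q (mor ?S p q C) = mor ?S p q (?\<phi> p C)"
    if q: "q \<in> base ?S" and pq: "p \<le> q" and C: "C \<in> obj ?S p" for p q C
  proof -
    obtain x where x: "x \<in> sublevel M f (snd p)" "C = ?c p x"
      using C unfolding rips_class_def by (rule density_rips_objE)
    have m: "mor ?S p q C = ?c q x"
      unfolding x(2) by (rule mor_class[OF pq x(1)])
    have xq: "x \<in> sublevel M f (snd q)"
      using x(1) pq sublevel_mono[of "snd p" "snd q" f] by (auto simp: less_eq_prod_def)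
    show ?thesis
    proof (cases "C \<subseteq> A")
      case True
      then have xA: "x \<in> A"
        using x rips_class_self by blast
      have "?\<phi> q (?c q x) = ?c q y"
        using merge[OF density_rips_grade_nonneg[OF q] xA xq] by (auto simp: collapse_def)
      moreover have "mor ?S p q (?\<phi> p C) = ?c q y"
        using True mor_class[OF pq y_present[OF x(1) xA]] by (simp add: collapse_def)
      ultimately show ?thesis
        by (simp add: m)
    next
      case False
      then have "\<not> mor ?S p q C \<subseteq> A"
        using density_rips_mor(2)[OF pq C] by blast
      then show ?thesis
        using False by (simp add: collapse_def)
    qed
  qed
  show ?thesis
    unfolding pset_morphism_def using maps natural by blast
qed

lemma collapse_idem:
  assumes "y \<notin> A" "y \<in> M" "\<And>x. x \<in> A \<Longrightarrow> f y \<le> f x"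
    and C: "C \<in> obj (density_rips M d f) p"
  shows "collapse M d f A y p (collapse M d f A y p C) = collapse M d f A y p C"
proof (cases "C \<subseteq> A")
  case True
  obtain x where x: "x \<in> sublevel M f (snd p)" "C = rips_class M d f p x"
    using C unfolding rips_class_def by (rule density_rips_objE)
  then have "x \<in> A"
    using True rips_class_self by blast
  then have "y \<in> sublevel M f (snd p)"
    using assms(2) assms(3)[of x] x(1) by (auto simp: sublevel_def)
  then have "\<not> rips_class M d f p y \<subseteq> A"
    using rips_class_self assms(1) by blast
  then show ?thesis
    by (simp add: collapse_def)
qed (simp add: collapse_def)

lemma fixed_by_collapse_iff:
  assumes "y \<notin> A" "y \<in> M" "\<And>x. x \<in> A \<Longrightarrow> f y \<le> f x"
  shows "fixed_by (collapse M d f A y) (point_generator f x) \<longleftrightarrow> x \<notin> A"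
proof (cases "x \<in> A")
  case True
  then have "rips_class M d f (0, f x) y = {y}"
    using assms(2,3) by (intro rips_class_zero) (simp add: sublevel_def)
  then show ?thesis
    using True assms(1) by (auto simp: fixed_by_def point_generator_def collapse_def)
qed (simp add: fixed_by_def point_generator_def collapse_def)

end

theorem proposition3p5:
  fixes M :: "'a set" and d :: "'a \<Rightarrow> 'a \<Rightarrow> real" and f :: "'a \<Rightarrow> real" and A :: "'a set"
  assumes "augmented_metric_space M d f"
    and "A \<subseteq> M" and "A \<noteq> {}"
    and "\<exists>y \<in> M - A. \<forall>x \<in> A. f y \<le> f x \<and>
           (\<forall>\<epsilon> \<sigma>. \<epsilon> \<ge> 0 \<longrightarrow> x \<in> sublevel M f \<sigma> \<longrightarrow>
              (x, y) \<in> path_conn d \<epsilon> (sublevel M f \<sigma>) \<or>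
              {z. (x, z) \<in> path_conn d \<epsilon> (sublevel M f \<sigma>)} \<subseteq> A)"
  shows "rooted_subset (density_rips M d f) (point_generator f ` A)"
proof -
  interpret Metric_space M d
    using assms(1) by (simp add: augmented_metric_space_def)
  let ?S = "density_rips M d f"
  obtain y where y: "y \<notin> A" "y \<in> M" and early: "\<And>x. x \<in> A \<Longrightarrow> f y \<le> f x"
    and dich: "\<And>x \<epsilon> \<sigma>. x \<in> A \<Longrightarrow> \<epsilon> \<ge> 0 \<Longrightarrow> x \<in> sublevel M f \<sigma> \<Longrightarrow>
      (x, y) \<in> path_conn d \<epsilon> (sublevel M f \<sigma>) \<or>
      {z. (x, z) \<in> path_conn d \<epsilon> (sublevel M f \<sigma>)} \<subseteq> A"
    using assms(4) by blast
  let ?\<phi> = "collapse M d f A y"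
  have "rips_class M d f p x = rips_class M d f p y"
    if "0 \<le> fst p" "x \<in> A" "x \<in> sublevel M f (snd p)" "\<not> rips_class M d f p x \<subseteq> A" for p x
  proof (rule rips_class_eq)
    show "(x, y) \<in> path_conn d (fst p) (sublevel M f (snd p))"
      using dich[OF that(2,1,3)] that(4) by (auto simp: rips_class_def)
  qed
  then have "pset_morphism ?S ?S ?\<phi>"
    using y early by (intro pset_morphism_collapse) auto
  then have "idempotent_endomorphism ?S ?\<phi>"
    unfolding idempotent_endomorphism_def using collapse_idem[where f = f, OF y early] by blast
  moreover have gens: "generators ?S = point_generator f ` M"
    using bij_betw_point_generator[of f] by (simp add: bij_betw_def)
  moreover have "{g \<in> generators ?S. \<not> fixed_by ?\<phi> g} = point_generator f ` A"
    unfolding gens using fixed_by_collapse_iff[where f = f, OF y early] assms(2) by blast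
  ultimately show ?thesis
    unfolding rooted_subset_def using assms(2,3) by blast
qed

end
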